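(* Let $G$ be a finite group, $k$ an infinite field, and let $G$ act on $V=k^d$ by a representation $G\to\operatorname{GL}(d,k)$ such that $V$ is a cyclic $kG$-module. Let $v\in\operatorname{Gens}(V)$ be such that the characteristic of $k$ does not divide the order of the stabilizer $H=G_v$ of $v$ in $G$. Then evaluation at $v$, $A(X)\mapsto A(v)$, yields an injective map $\operatorname{GL}(GX)\to\operatorname{GL}(Gv)$.
   Context: $\operatorname{Gens}(V)=\{v\in V : V=kGv\}$, where $kGv$ is the $k$-span of $Gv$; $V$ is cyclic if $\operatorname{Gens}(V)\ne\emptyset$. For $v\in\operatorname{Gens}(V)$, $\operatorname{GL}(Gv)$ is the group of all $A\in\operatorname{GL}(d,k)$ with $A(Gv)=Gv$. Let $X=(X_1,\dots,X_d)^t$ be a vector of indeterminates; $G$ acts on $k(X)^d$ by the same matrices, where $k(X)=k(X_1,\dots,X_d)$, and $\operatorname{GL}(GX)$ is the group of all $A\in\operatorname{GL}(d,k(X))$ which map the orbit $GX$ onto itself. For every $A(X)\in\operatorname{GL}(GX)$ and $v\in \operatorname{Gens}(V)$, the entries of $A(X)$ are rational functions which can be evaluated at $v$, and the resulting matrix $A(v)$ lies in $\operatorname{GL}(Gv)$. *)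

theory Defs
  imports
    "HOL-Analysis.Analysis"
    "HOL-Algebra.Group_Action"
    "HOL-Library.Poly_Mapping"
    "HOL-Computational_Algebra.Fraction_Field"
begin

text \<open>
  The indeterminates \<open>X\<^sub>i\<close> are indexed by the same finite type \<open>'n\<close> that indexes the coordinates
  of \<open>k\<^sup>d\<close>, so \<open>d = CARD('n)\<close>. The inner \<open>'n \<Rightarrow>\<^sub>0 nat\<close> is the monoid of exponent vectors. The linear
  order on \<open>'n\<close> is only there because the library needs it for the integral domain instance.
\<close>

type_synonym ('n, 'k) mpoly = "('n \<Rightarrow>\<^sub>0 nat) \<Rightarrow>\<^sub>0 'k"
type_synonym ('n, 'k) ratfun = "('n, 'k) mpoly fract"

definition mpoly_const :: "'k::field \<Rightarrow> ('n::{finite,linorder}, 'k) mpoly" where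
  "mpoly_const c = Poly_Mapping.single 0 c"

definition mpoly_var :: "'n::{finite,linorder} \<Rightarrow> ('n, 'k::field) mpoly" where
  "mpoly_var i = Poly_Mapping.single (Poly_Mapping.single i 1) 1"

definition mpoly_eval :: "('n, 'k::field) mpoly \<Rightarrow> 'k^'n::{finite,linorder} \<Rightarrow> 'k" where
  "mpoly_eval p v =
     (\<Sum>m\<in>Poly_Mapping.keys p. Poly_Mapping.lookup p m * (\<Prod>i\<in>UNIV. v $ i ^ Poly_Mapping.lookup m i))"

definition ratfun_const :: "'k::field \<Rightarrow> ('n::{finite,linorder}, 'k) ratfun" where
  "ratfun_const c = Fract (mpoly_const c) 1"

definition generic_vec :: "('n, 'k::field) ratfun ^ 'n::{finite,linorder}" where
  "generic_vec = (\<chi> i. Fract (mpoly_var i) 1)"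

definition ratfun_defined_at ::
    "('n, 'k::field) ratfun \<Rightarrow> 'k^'n::{finite,linorder} \<Rightarrow> bool" where
  "ratfun_defined_at r v \<longleftrightarrow> (\<exists>p q. r = Fract p q \<and> mpoly_eval q v \<noteq> 0)"

text \<open>
  The condition \<open>mpoly_eval q v \<noteq> 0\<close> already forces \<open>q \<noteq> 0\<close>. The value is unspecified where the
  rational function is not defined; independence of the representing fraction is
  \<open>ratfun_eval_Fract\<close> below.
\<close>

definition ratfun_eval ::
    "('n, 'k::field) ratfun \<Rightarrow> 'k^'n::{finite,linorder} \<Rightarrow> 'k" where
  "ratfun_eval r v =
     (THE c. \<exists>p q. r = Fract p q \<and> mpoly_eval q v \<noteq> 0 \<and> c = mpoly_eval p v / mpoly_eval q v)"

definition ratmat_defined_at ::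
    "('n, 'k::field) ratfun ^ 'n::{finite,linorder} ^ 'n::{finite,linorder}
      \<Rightarrow> 'k^'n::{finite,linorder} \<Rightarrow> bool" where
  "ratmat_defined_at A v \<longleftrightarrow> (\<forall>i j. ratfun_defined_at (A $ i $ j) v)"

definition ratmat_eval ::
    "('n, 'k::field) ratfun ^ 'n::{finite,linorder} ^ 'n::{finite,linorder}
      \<Rightarrow> 'k^'n::{finite,linorder} \<Rightarrow> 'k^'n::{finite,linorder}^'n::{finite,linorder}" where
  "ratmat_eval A v = map_matrix (\<lambda>r. ratfun_eval r v) A"

lemma mpoly_eval_superset:
  assumes "finite S" "Poly_Mapping.keys p \<subseteq> S"
  shows "mpoly_eval p v =
    (\<Sum>m\<in>S. Poly_Mapping.lookup p m * (\<Prod>i\<in>UNIV. v $ i ^ Poly_Mapping.lookup m i))"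
  unfolding mpoly_eval_def
  by (rule sum.mono_neutral_left) (use assms in \<open>auto simp: in_keys_iff\<close>)

lemma mpoly_eval_add: "mpoly_eval (p + q) v = mpoly_eval p v + mpoly_eval q v"
proof -
  let ?S = "Poly_Mapping.keys p \<union> Poly_Mapping.keys q"
  have "Poly_Mapping.keys (p + q) \<subseteq> ?S"
    by (rule Poly_Mapping.keys_add)
  then show ?thesis
    by (simp add: mpoly_eval_superset[of ?S] lookup_add distrib_right sum.distrib)
qed

lemma mpoly_eval_0 [simp]: "mpoly_eval 0 v = 0"
  by (simp add: mpoly_eval_def)

lemma mpoly_eval_single:
  "mpoly_eval (Poly_Mapping.single m c) v = c * (\<Prod>i\<in>UNIV. v $ i ^ Poly_Mapping.lookup m i)"
  by (simp add: mpoly_eval_superset[of "{m}"])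

lemma mpoly_induct [case_names zero single add]:
  fixes p :: "'a \<Rightarrow>\<^sub>0 'b::comm_monoid_add"
  assumes "P 0" "\<And>m c. P (Poly_Mapping.single m c)" "\<And>p q. P p \<Longrightarrow> P q \<Longrightarrow> P (p + q)"
  shows "P p"
proof (induction p rule: update_induct)
  case const
  show ?case by (rule assms)
next
  case (update f a b)
  have "Poly_Mapping.update a b f = f + Poly_Mapping.single a b"
    using update by (intro poly_mapping_eqI) (auto simp: lookup_update lookup_add lookup_single in_keys_iff)
  then show ?case using update assms by metis
qed

lemma mpoly_eval_mult: "mpoly_eval (p * q) v = mpoly_eval p v * mpoly_eval q v"
proof (induction p rule: mpoly_induct)
  case (single m c)
  show ?case
  proof (induction q rule: mpoly_induct)
    case (single m' c')
    then show ?case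
      by (simp add: mult_single mpoly_eval_single lookup_add power_add prod.distrib algebra_simps)
  qed (simp_all add: mpoly_eval_add distrib_left)
qed (simp_all add: mpoly_eval_add distrib_right)

lemma ratfun_eval_Fract:
  fixes p q :: "('n::{finite,linorder}, 'k::field) mpoly"
  assumes "mpoly_eval q v \<noteq> 0"
  shows "ratfun_eval (Fract p q) v = mpoly_eval p v / mpoly_eval q v"
  unfolding ratfun_eval_def
proof (rule the_equality)
  fix c
  assume "\<exists>p' q'. Fract p q = Fract p' q' \<and> mpoly_eval q' v \<noteq> 0 \<and>
            c = mpoly_eval p' v / mpoly_eval q' v"
  then obtain p' q' where *: "Fract p q = Fract p' q'" "mpoly_eval q' v \<noteq> 0"
    "c = mpoly_eval p' v / mpoly_eval q' v" by blast
  have "q \<noteq> 0" "q' \<noteq> 0" using assms * by auto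
  then have "p * q' = p' * q" using * by (simp add: eq_fract)
  then have "mpoly_eval p v * mpoly_eval q' v = mpoly_eval p' v * mpoly_eval q v"
    by (metis mpoly_eval_mult)
  then show "c = mpoly_eval p v / mpoly_eval q v"
    using assms * by (simp add: frac_eq_eq)
qed (use assms in blast)

definition general_linear_group :: "('k::field^'n^'n) monoid" where
  "general_linear_group = \<lparr>carrier = {A. invertible A}, mult = (**), one = mat 1\<rparr>"

definition matrix_action :: "('g \<Rightarrow> 'k::field^'n^'n) \<Rightarrow> 'g \<Rightarrow> 'k^'n \<Rightarrow> 'k^'n" where
  "matrix_action \<rho> g x = \<rho> g *v x"

definition generic_rep ::
    "('g \<Rightarrow> 'k::field^'n::{finite,linorder}^'n::{finite,linorder}) \<Rightarrow> 'g
      \<Rightarrow> ('n, 'k) ratfun ^ 'n::{finite,linorder} ^ 'n::{finite,linorder}" where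
  "generic_rep \<rho> g = map_matrix ratfun_const (\<rho> g)"

definition Gens :: "('g, 'b) monoid_scheme \<Rightarrow> ('g \<Rightarrow> 'k::field^'n^'n) \<Rightarrow> ('k^'n) set" where
  "Gens G \<rho> = {v. UNIV = vec.span (orbit G (matrix_action \<rho>) v)}"

definition cyclic_module :: "('g, 'b) monoid_scheme \<Rightarrow> ('g \<Rightarrow> 'k::field^'n^'n) \<Rightarrow> bool" where
  "cyclic_module G \<rho> \<longleftrightarrow> Gens G \<rho> \<noteq> {}"

text \<open>
  \<open>GL_orbit G \<rho> v\<close> is \<open>GL(Gv)\<close>, and \<open>GL_orbit G (generic_rep \<rho>) generic_vec\<close> is \<open>GL(GX)\<close>, the
  instance with \<open>k(X)\<close> as base field.
\<close>

definition GL_orbit ::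
    "('g, 'b) monoid_scheme \<Rightarrow> ('g \<Rightarrow> 'k::field^'n^'n) \<Rightarrow> 'k^'n \<Rightarrow> ('k^'n^'n) set" where
  "GL_orbit G \<rho> x =
     {A. invertible A \<and> (\<lambda>y. A *v y) ` orbit G (matrix_action \<rho>) x = orbit G (matrix_action \<rho>) x}"

end

theory Submission
  imports Defs
begin

text \<open>
  A rational matrix \<open>A\<close> is determined by its action on vectors whose values at \<open>v\<close> span \<open>k\<^sup>d\<close>, and
  by Cramer's rule it is defined at \<open>v\<close> as soon as the images of these vectors are. For
  \<open>A \<in> GL(GX)\<close> apply this to the orbit \<open>GX\<close>, whose values at \<open>v\<close> form \<open>Gv\<close>; so \<open>A(v)\<close> exists
  and permutes \<open>Gv\<close>.

  For injectivity, let \<open>S\<^sub>g\<close> be the set of all \<open>y \<in> GX\<close> with \<open>y(v) = gv\<close>. If \<open>A(v) = B(v)\<close>, then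
  \<open>A\<close> and \<open>B\<close> map \<open>S\<^sub>g\<close> onto the same set, namely all \<open>y \<in> GX\<close> with \<open>y(v) = A(v)gv\<close>, so they agree
  on the sum of \<open>S\<^sub>g\<close>. Its value at \<open>v\<close> is \<open>|S\<^sub>g| gv\<close>, where \<open>|S\<^sub>g|\<close> divides \<open>|H|\<close> and hence is
  invertible in \<open>k\<close>. So these sums have values that span \<open>k\<^sup>d\<close>, and \<open>A = B\<close>.
\<close>

section \<open>Evaluation of polynomials and rational functions at a point\<close>

lemma mpoly_eval_1 [simp]:
  "mpoly_eval (1 :: ('n::{finite,linorder}, 'k::field) mpoly) v = 1"
  using mpoly_eval_single[of 0 1 v] by simp

lemma mpoly_eval_uminus: "mpoly_eval (- p) v = - mpoly_eval p v"
  using mpoly_eval_add[of p "- p" v] by (simp add: eq_neg_iff_add_eq_0 add.commute)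

lemma mpoly_eval_const [simp]: "mpoly_eval (mpoly_const c) v = c"
  by (simp add: mpoly_const_def mpoly_eval_single)

lemma mpoly_eval_var [simp]: "mpoly_eval (mpoly_var i) v = v $ i"
proof -
  \<comment> \<open>The exponent vector of \<open>mpoly_var i\<close> is the indicator of
    \<open>i\<close>. With the case distinction moved out of the exponent, the product collapses to
    its factor at \<open>i\<close>.\<close>
  have "(\<Prod>j\<in>UNIV. v $ j ^ (if i = j then Suc 0 else 0)) = (\<Prod>j\<in>UNIV. if i = j then v $ j else 1)"
    by (rule prod.cong) auto
  then show ?thesis
    by (simp add: mpoly_var_def mpoly_eval_single lookup_single when_def)
qed

lemma ratfun_Fract:
  assumes "mpoly_eval q v \<noteq> 0"
  shows "ratfun_defined_at (Fract p q) v"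
    and "ratfun_eval (Fract p q) v = mpoly_eval p v / mpoly_eval q v"
  using assms ratfun_eval_Fract by (auto simp: ratfun_defined_at_def)

lemma ratfun_defined_atE:
  assumes "ratfun_defined_at r v"
  obtains p q where "r = Fract p q" "mpoly_eval q v \<noteq> 0" "q \<noteq> 0"
    "ratfun_eval r v = mpoly_eval p v / mpoly_eval q v"
  using assms unfolding ratfun_defined_at_def by (metis mpoly_eval_0 ratfun_eval_Fract)

lemma ratfun_const_at [simp]:
  "ratfun_defined_at (ratfun_const c) v" "ratfun_eval (ratfun_const c) v = c"
  by (simp_all add: ratfun_const_def ratfun_Fract)

lemma ratfun_add_at:
  assumes "ratfun_defined_at r v" "ratfun_defined_at s v"
  shows "ratfun_defined_at (r + s) v"
    and "ratfun_eval (r + s) v = ratfun_eval r v + ratfun_eval s v"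
proof -
  obtain p q where r: "r = Fract p q" "mpoly_eval q v \<noteq> 0" "q \<noteq> 0"
    "ratfun_eval r v = mpoly_eval p v / mpoly_eval q v"
    using assms(1) by (rule ratfun_defined_atE)
  obtain p' q' where s: "s = Fract p' q'" "mpoly_eval q' v \<noteq> 0" "q' \<noteq> 0"
    "ratfun_eval s v = mpoly_eval p' v / mpoly_eval q' v"
    using assms(2) by (rule ratfun_defined_atE)
  have "r + s = Fract (p * q' + p' * q) (q * q')" using r s by simp
  moreover have "mpoly_eval (q * q') v \<noteq> 0" using r s by (simp add: mpoly_eval_mult)
  ultimately show "ratfun_defined_at (r + s) v"
    "ratfun_eval (r + s) v = ratfun_eval r v + ratfun_eval s v"
    using r s by (simp_all add: ratfun_Fract mpoly_eval_add mpoly_eval_mult add_frac_eq mult.commute)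
qed

lemma ratfun_mult_at:
  assumes "ratfun_defined_at r v" "ratfun_defined_at s v"
  shows "ratfun_defined_at (r * s) v"
    and "ratfun_eval (r * s) v = ratfun_eval r v * ratfun_eval s v"
proof -
  obtain p q where r: "r = Fract p q" "mpoly_eval q v \<noteq> 0" "q \<noteq> 0"
    "ratfun_eval r v = mpoly_eval p v / mpoly_eval q v"
    using assms(1) by (rule ratfun_defined_atE)
  obtain p' q' where s: "s = Fract p' q'" "mpoly_eval q' v \<noteq> 0" "q' \<noteq> 0"
    "ratfun_eval s v = mpoly_eval p' v / mpoly_eval q' v"
    using assms(2) by (rule ratfun_defined_atE)
  have "r * s = Fract (p * p') (q * q')" using r s by simp
  moreover have "mpoly_eval (q * q') v \<noteq> 0" using r s by (simp add: mpoly_eval_mult)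
  ultimately show "ratfun_defined_at (r * s) v"
    "ratfun_eval (r * s) v = ratfun_eval r v * ratfun_eval s v"
    using r s by (simp_all add: ratfun_Fract mpoly_eval_mult)
qed

lemma ratfun_uminus_at:
  assumes "ratfun_defined_at r v"
  shows "ratfun_defined_at (- r) v" "ratfun_eval (- r) v = - ratfun_eval r v"
proof -
  obtain p q where r: "r = Fract p q" "mpoly_eval q v \<noteq> 0" "q \<noteq> 0"
    "ratfun_eval r v = mpoly_eval p v / mpoly_eval q v"
    using assms(1) by (rule ratfun_defined_atE)
  then show "ratfun_defined_at (- r) v" "ratfun_eval (- r) v = - ratfun_eval r v"
    by (simp_all add: ratfun_Fract mpoly_eval_uminus)
qed

text \<open>A nonzero value of \<open>s\<close> means that its numerator \<open>p'\<close> does not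
  vanish at \<open>v\<close>, so \<open>q * p'\<close> can serve as denominator of the
  quotient.\<close>

lemma ratfun_defined_at_divide:
  assumes "ratfun_defined_at r v" "ratfun_defined_at s v" "ratfun_eval s v \<noteq> 0"
  shows "ratfun_defined_at (r / s) v"
proof -
  obtain p q where r: "r = Fract p q" "mpoly_eval q v \<noteq> 0"
    using assms(1) by (rule ratfun_defined_atE)
  obtain p' q' where s: "s = Fract p' q'" "mpoly_eval q' v \<noteq> 0" "q' \<noteq> 0"
    "ratfun_eval s v = mpoly_eval p' v / mpoly_eval q' v"
    using assms(2) by (rule ratfun_defined_atE)
  have "mpoly_eval (q * p') v \<noteq> 0" using r s assms(3) by (simp add: mpoly_eval_mult)
  then show ?thesis using r s by (simp add: ratfun_Fract)
qed

lemma ratfun_0_at [simp]: "ratfun_defined_at 0 v" "ratfun_eval 0 v = 0"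
  by (simp_all add: Zero_fract_def ratfun_Fract)

lemma ratfun_1_at [simp]: "ratfun_defined_at 1 v" "ratfun_eval 1 v = 1"
  by (simp_all add: One_fract_def ratfun_Fract)

text \<open>Both claims go through one induction, because splitting the value of a sum presupposes
  that the remaining sum is defined at \<open>v\<close>.\<close>

lemma ratfun_sum_at:
  assumes "\<And>i. i \<in> I \<Longrightarrow> ratfun_defined_at (f i) v"
  shows "ratfun_defined_at (\<Sum>i\<in>I. f i) v \<and>
    ratfun_eval (\<Sum>i\<in>I. f i) v = (\<Sum>i\<in>I. ratfun_eval (f i) v)"
  using assms by (induction I rule: infinite_finite_induct) (simp_all add: ratfun_add_at)

lemma ratfun_prod_at:
  assumes "\<And>i. i \<in> I \<Longrightarrow> ratfun_defined_at (f i) v"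
  shows "ratfun_defined_at (\<Prod>i\<in>I. f i) v \<and>
    ratfun_eval (\<Prod>i\<in>I. f i) v = (\<Prod>i\<in>I. ratfun_eval (f i) v)"
  using assms by (induction I rule: infinite_finite_induct) (simp_all add: ratfun_mult_at)

lemma ratfun_sign_at:
  "ratfun_defined_at (of_int (sign p)) v" "ratfun_eval (of_int (sign p)) v = of_int (sign p)"
  by (simp_all add: sign_def ratfun_uminus_at)

lemma ratmat_eval_nth [simp]: "ratmat_eval A v $ i $ j = ratfun_eval (A $ i $ j) v"
  by (simp add: ratmat_eval_def)

text \<open>By the Leibniz formula the determinant is a signed sum of products of entries, and
  evaluation at \<open>v\<close> respects each of these operations.\<close>

lemma ratfun_det_at:
  assumes "ratmat_defined_at M v"
  shows "ratfun_defined_at (det M) v \<and> ratfun_eval (det M) v = det (ratmat_eval M v)"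
proof -
  have *: "ratfun_defined_at (M $ i $ j) v" for i j
    using assms by (simp add: ratmat_defined_at_def)
  have "ratfun_defined_at (\<Prod>i\<in>UNIV. M $ i $ p i) v \<and>
      ratfun_eval (\<Prod>i\<in>UNIV. M $ i $ p i) v = (\<Prod>i\<in>UNIV. ratfun_eval (M $ i $ p i) v)" for p
    by (rule ratfun_prod_at) (rule *)
  then show ?thesis
    unfolding det_def
    using ratfun_sum_at[of "{p. p permutes (UNIV :: 'a set)}"
        "\<lambda>p. of_int (sign p) * (\<Prod>i\<in>UNIV. M $ i $ p i)" v]
    by (simp add: ratfun_mult_at ratfun_sign_at)
qed

section \<open>Linear algebra over the rational functions defined at a point\<close>

definition ratvec_defined_at ::
    "('n, 'k::field) ratfun ^ 'n::{finite,linorder} \<Rightarrow> 'k^'n::{finite,linorder} \<Rightarrow> bool" where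
  "ratvec_defined_at x v \<longleftrightarrow> (\<forall>i. ratfun_defined_at (x $ i) v)"

definition ratvec_eval ::
    "('n, 'k::field) ratfun ^ 'n::{finite,linorder} \<Rightarrow> 'k^'n::{finite,linorder}
      \<Rightarrow> 'k^'n::{finite,linorder}" where
  "ratvec_eval x v = (\<chi> i. ratfun_eval (x $ i) v)"

lemma ratvec_mult_at:
  assumes "ratmat_defined_at A v" "ratvec_defined_at x v"
  shows "ratvec_defined_at (A *v x) v"
    and "ratvec_eval (A *v x) v = ratmat_eval A v *v ratvec_eval x v"
proof -
  have "ratfun_defined_at (A $ i $ j * x $ j) v \<and>
      ratfun_eval (A $ i $ j * x $ j) v = ratfun_eval (A $ i $ j) v * ratfun_eval (x $ j) v" for i j
    using assms by (simp add: ratmat_defined_at_def ratvec_defined_at_def ratfun_mult_at)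
  then show "ratvec_defined_at (A *v x) v"
    "ratvec_eval (A *v x) v = ratmat_eval A v *v ratvec_eval x v"
    using ratfun_sum_at[of UNIV "\<lambda>j. A $ i $ j * x $ j" v for i]
    by (simp_all add: ratvec_defined_at_def ratvec_eval_def matrix_vector_mult_def vec_eq_iff)
qed

lemma ratvec_sum_at:
  assumes "\<And>i. i \<in> I \<Longrightarrow> ratvec_defined_at (f i) v"
  shows "ratvec_defined_at (\<Sum>i\<in>I. f i) v"
    and "ratvec_eval (\<Sum>i\<in>I. f i) v = (\<Sum>i\<in>I. ratvec_eval (f i) v)"
  using assms ratfun_sum_at[of I "\<lambda>j. f j $ i" v for i]
  by (simp_all add: ratvec_defined_at_def ratvec_eval_def vec_eq_iff)

text \<open>Cramer's rule: each coordinate of \<open>x\<close> is the determinant of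
  \<open>?C\<close>, whose entries come from \<open>M\<close> and \<open>M *v x\<close>, divided by
  \<open>det M\<close>, whose value at \<open>v\<close> is nonzero.\<close>

lemma ratvec_defined_at_solution:
  assumes M: "ratmat_defined_at M v" and det: "det (ratmat_eval M v) \<noteq> 0"
    and b: "ratvec_defined_at (M *v x) v"
  shows "ratvec_defined_at x v"
  unfolding ratvec_defined_at_def
proof
  fix k
  let ?C = "\<chi> i j. if j = k then (M *v x) $ i else M $ i $ j"
  have detM: "ratfun_defined_at (det M) v" "ratfun_eval (det M) v \<noteq> 0"
    using ratfun_det_at[OF M] det by simp_all
  then have "det M \<noteq> 0" by auto
  then have "x $ k = det ?C / det M"
    unfolding cramer_lemma by simp
  moreover have "ratmat_defined_at ?C v"
    using M b by (simp add: ratmat_defined_at_def ratvec_defined_at_def)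
  ultimately show "ratfun_defined_at (x $ k) v"
    using ratfun_defined_at_divide[OF _ detM] ratfun_det_at[of ?C v] by (simp only:)
qed

text \<open>Select a basis of the space among the values, lift each basis vector to an element of
  \<open>W\<close>, and use the lifts as columns.\<close>

lemma spanning_values_matrix:
  fixes W :: "(('n::{finite,linorder}, 'k::field) ratfun ^ 'n::{finite,linorder}) set"
  assumes "vec.span ((\<lambda>w. ratvec_eval w v) ` W) = UNIV"
  obtains M where "\<And>j. column j M \<in> W" "det (ratmat_eval M v) \<noteq> 0"
proof -
  obtain B where B: "B \<subseteq> (\<lambda>w. ratvec_eval w v) ` W" "vec.independent B"
    "(\<lambda>w. ratvec_eval w v) ` W \<subseteq> vec.span B"
    "card B = vec.dim ((\<lambda>w. ratvec_eval w v) ` W)"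
    by (rule vec.basis_exists)
  have span: "vec.span B = UNIV"
    using B(3) assms vec.span_minimal[OF _ vec.subspace_span] by blast
  have "card B = CARD('n)"
    using B(4) assms vec_dim_card vec.dim_span by metis
  moreover have "finite B" using B(2) vec.finiteI_independent by blast
  \<comment> \<open>A basis has as many elements as there are coordinates, so its elements can be
    indexed by the columns of a square matrix.\<close>
  ultimately obtain f where f: "bij_betw f (UNIV :: 'n set) B"
    by (metis finite finite_same_card_bij)
  then have "\<forall>j. \<exists>w\<in>W. f j = ratvec_eval w v"
    using B(1) bij_betwE by blast
  then obtain w where w: "\<And>j. w j \<in> W" "\<And>j. f j = ratvec_eval (w j) v" by metis
  define M where "M = (\<chi> i j. w j $ i)"
  have col: "column j M = w j" for j by (simp add: M_def column_def vec_eq_iff)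
  have "column j (ratmat_eval M v) = f j" for j
    by (simp add: w M_def column_def ratvec_eval_def vec_eq_iff)
  then have "columns (ratmat_eval M v) = B"
    using f by (auto simp: columns_def bij_betw_def)
  then have "\<exists>N. ratmat_eval M v ** N = mat 1"
    using span matrix_right_invertible_span_columns by metis
  then have "det (ratmat_eval M v) \<noteq> 0"
    using invertible_det_nz invertible_right_inverse by blast
  then show thesis using that col w by metis
qed

lemma ratmat_defined_at_columns:
  "ratmat_defined_at M v \<longleftrightarrow> (\<forall>j. ratvec_defined_at (column j M) v)"
  by (auto simp: ratmat_defined_at_def ratvec_defined_at_def column_def)

lemma ratmat_eval_transpose: "ratmat_eval (transpose A) v = transpose (ratmat_eval A v)"
  by (simp add: vec_eq_iff transpose_def)

text \<open>With \<open>M\<close> a matrix of columns from \<open>W\<close> that is invertible at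
  \<open>v\<close>, each row of \<open>A\<close> solves a linear system with matrix
  \<open>transpose M\<close>, whose right-hand side consists of coordinates of the images of these
  columns.\<close>

lemma ratmat_defined_at_if_images_defined:
  fixes W :: "(('n::{finite,linorder}, 'k::field) ratfun ^ 'n::{finite,linorder}) set"
  assumes span: "vec.span ((\<lambda>w. ratvec_eval w v) ` W) = UNIV"
    and W: "\<And>w. w \<in> W \<Longrightarrow> ratvec_defined_at w v"
    and AW: "\<And>w. w \<in> W \<Longrightarrow> ratvec_defined_at (A *v w) v"
  shows "ratmat_defined_at A v"
proof -
  obtain M where M: "\<And>j. column j M \<in> W" "det (ratmat_eval M v) \<noteq> 0"
    using spanning_values_matrix[OF span] by metis
  have Mdef: "ratmat_defined_at M v" using M W by (simp add: ratmat_defined_at_columns)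
  have "ratvec_defined_at (A $ i) v" for i
  proof (rule ratvec_defined_at_solution)
    show "ratmat_defined_at (transpose M) v"
      using Mdef by (simp add: ratmat_defined_at_def transpose_def)
    show "det (ratmat_eval (transpose M) v) \<noteq> 0"
      using M by (simp add: ratmat_eval_transpose)
    have "transpose M *v (A $ i) = (\<chi> j. (A *v column j M) $ i)"
      by (simp add: vec_eq_iff transpose_def column_def matrix_vector_mult_def mult.commute)
    then show "ratvec_defined_at (transpose M *v (A $ i)) v"
      using AW M(1) by (simp add: ratvec_defined_at_def)
  qed
  then show ?thesis by (simp add: ratmat_defined_at_def ratvec_defined_at_def)
qed

text \<open>Choose \<open>M\<close> with columns in \<open>W\<close> and nonzero determinant at
  \<open>v\<close>. Then \<open>M\<close> is invertible over the rational functions and can be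
  cancelled from \<open>A ** M = B ** M\<close>.\<close>

lemma ratmat_eq_on_spanning_values:
  fixes W :: "(('n::{finite,linorder}, 'k::field) ratfun ^ 'n::{finite,linorder}) set"
    and A B :: "('n, 'k) ratfun ^ 'n::{finite,linorder} ^ 'm"
  assumes span: "vec.span ((\<lambda>w. ratvec_eval w v) ` W) = UNIV"
    and W: "\<And>w. w \<in> W \<Longrightarrow> ratvec_defined_at w v"
    and eq: "\<And>w. w \<in> W \<Longrightarrow> A *v w = B *v w"
  shows "A = B"
proof -
  obtain M where M: "\<And>j. column j M \<in> W" "det (ratmat_eval M v) \<noteq> 0"
    using spanning_values_matrix[OF span] by metis
  have "ratmat_defined_at M v" using M W by (simp add: ratmat_defined_at_columns)
  then have "det M \<noteq> 0" using M(2) ratfun_det_at[of M v] by auto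
  then obtain N where N: "M ** N = mat 1"
    using invertible_det_nz invertible_right_inverse by blast
  have column: "(C ** M) $ i $ j = (C *v column j M) $ i"
    for C :: "('n, 'k) ratfun ^ 'n::{finite,linorder} ^ 'm" and i j
    by (simp add: matrix_matrix_mult_def matrix_vector_mult_def column_def)
  have "(A ** M) $ i $ j = (B ** M) $ i $ j" for i j
    by (simp only: column eq[OF M(1)])
  then have "A ** M = B ** M" by (simp add: vec_eq_iff)
  then have "A ** (M ** N) = B ** (M ** N)" by (simp add: matrix_mul_assoc)
  then show ?thesis by (simp add: N)
qed

section \<open>Fibres of orbit maps\<close>

lemma rep_mult:
  assumes "\<rho> \<in> hom G general_linear_group" "g \<in> carrier G" "h \<in> carrier G"
  shows "\<rho> (g \<otimes>\<^bsub>G\<^esub> h) *v x = \<rho> g *v (\<rho> h *v x)"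
  using assms by (simp add: hom_def general_linear_group_def matrix_vector_mul_assoc)

lemma rep_invertible:
  assumes "\<rho> \<in> hom G general_linear_group" "g \<in> carrier G"
  shows "invertible (\<rho> g)"
  using assms by (auto simp: hom_def general_linear_group_def)

lemma rep_inj:
  assumes "\<rho> \<in> hom G general_linear_group" "g \<in> carrier G" "\<rho> g *v x = \<rho> g *v y"
  shows "x = y"
  using inj_matrix_vector_mult[OF rep_invertible[OF assms(1,2)]] assms(3) by (auto dest: injD)

text \<open>The fibre of the orbit map through \<open>g\<close> is the left coset of the stabilizer
  by \<open>g\<close>.\<close>

lemma card_action_fibre:
  assumes "group G" "\<rho> \<in> hom G general_linear_group" "g \<in> carrier G"
  shows "card {a \<in> carrier G. \<rho> a *v x = \<rho> g *v x} = card (stabilizer G (matrix_action \<rho>) x)"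
proof -
  interpret group G by fact
  let ?H = "stabilizer G (matrix_action \<rho>) x"
  have "{a \<in> carrier G. \<rho> a *v x = \<rho> g *v x} = (\<lambda>h. g \<otimes>\<^bsub>G\<^esub> h) ` ?H"
  proof (intro equalityI subsetI)
    fix a assume a: "a \<in> {a \<in> carrier G. \<rho> a *v x = \<rho> g *v x}"
    let ?h = "inv\<^bsub>G\<^esub> g \<otimes>\<^bsub>G\<^esub> a"
    have h: "?h \<in> carrier G" "g \<otimes>\<^bsub>G\<^esub> ?h = a"
      using a assms(3) by (auto simp flip: m_assoc)
    have "\<rho> g *v (\<rho> ?h *v x) = \<rho> a *v x"
      using rep_mult[OF assms(2,3) h(1)] h(2) by simp
    then have "\<rho> g *v (\<rho> ?h *v x) = \<rho> g *v x" using a by simp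
    then have "\<rho> ?h *v x = x" by (rule rep_inj[OF assms(2,3)])
    then have "?h \<in> ?H" using h(1) by (simp add: stabilizer_def matrix_action_def)
    with h(2) show "a \<in> (\<lambda>h. g \<otimes>\<^bsub>G\<^esub> h) ` ?H" by (metis imageI)
  qed (use assms in \<open>auto simp: stabilizer_def matrix_action_def rep_mult\<close>)
  moreover have "inj_on (\<lambda>h. g \<otimes>\<^bsub>G\<^esub> h) ?H"
    using assms(3) by (auto simp: inj_on_def stabilizer_def)
  ultimately show ?thesis by (simp add: card_image)
qed

section \<open>The generic representation and the values of its orbit\<close>

lemma ratfun_const_hom:
  "ratfun_const 0 = 0" "ratfun_const 1 = 1"
  "ratfun_const (a + b) = ratfun_const a + ratfun_const b"
  "ratfun_const (a * b) = ratfun_const a * ratfun_const b"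
  by (simp_all add: ratfun_const_def mpoly_const_def single_add mult_single
      flip: Zero_fract_def One_fract_def)

lemma ratfun_const_sum: "ratfun_const (\<Sum>i\<in>I. f i) = (\<Sum>i\<in>I. ratfun_const (f i))"
  by (induction I rule: infinite_finite_induct) (simp_all add: ratfun_const_hom)

lemma generic_rep_hom:
  fixes \<rho> :: "'g \<Rightarrow> 'k::field ^ 'n::{finite,linorder} ^ 'n::{finite,linorder}"
  assumes "\<rho> \<in> hom G general_linear_group"
  shows "generic_rep \<rho> \<in> hom G general_linear_group"
proof -
  let ?c = "map_matrix ratfun_const :: 'k ^ 'n::{finite,linorder} ^ 'n::{finite,linorder}
    \<Rightarrow> ('n, 'k) ratfun ^ 'n::{finite,linorder} ^ 'n::{finite,linorder}"
  have mult: "?c (A ** B) = ?c A ** ?c B" for A B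
    by (simp add: vec_eq_iff matrix_matrix_mult_def ratfun_const_sum ratfun_const_hom)
  have one: "?c (mat 1) = mat 1"
    by (simp add: vec_eq_iff mat_def ratfun_const_hom)
  have "invertible (?c A)" if "invertible A" for A
    using that mult one unfolding invertible_def by metis
  then show ?thesis
    using assms mult by (auto simp: hom_def Pi_iff general_linear_group_def generic_rep_def)
qed

text \<open>Constants evaluate to themselves and the generic vector evaluates to
  \<open>v\<close>.\<close>

lemma generic_orbit_at:
  fixes \<rho> :: "'g \<Rightarrow> 'k::field ^ 'n::{finite,linorder} ^ 'n::{finite,linorder}"
  shows "ratvec_defined_at (generic_rep \<rho> g *v generic_vec) v"
    and "ratvec_eval (generic_rep \<rho> g *v generic_vec) v = \<rho> g *v v"
proof -
  have "ratmat_defined_at (generic_rep \<rho> g) v" "ratmat_eval (generic_rep \<rho> g) v = \<rho> g"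
    by (simp_all add: ratmat_defined_at_def generic_rep_def vec_eq_iff)
  moreover have "ratvec_defined_at generic_vec v" "ratvec_eval generic_vec v = v"
    by (simp_all add: ratvec_defined_at_def ratvec_eval_def generic_vec_def ratfun_Fract vec_eq_iff)
  ultimately show "ratvec_defined_at (generic_rep \<rho> g *v generic_vec) v"
    "ratvec_eval (generic_rep \<rho> g *v generic_vec) v = \<rho> g *v v"
    using ratvec_mult_at by metis+
qed

text \<open>The set \<open>?F\<close> of group elements sending \<open>v\<close> to
  \<open>\<rho> g *v v\<close> has the order of the stabilizer of \<open>v\<close>. The generic
  orbit map sends \<open>?F\<close> onto \<open>?S\<close>, and all its fibres there have the order
  of the stabilizer \<open>?K\<close> of the generic vector; the cofactor is therefore
  \<open>card ?K\<close>.\<close>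

lemma card_orbit_values_dvd:
  fixes \<rho> :: "'g \<Rightarrow> 'k::field ^ 'n::{finite,linorder} ^ 'n::{finite,linorder}"
  assumes "group G" "finite (carrier G)" "\<rho> \<in> hom G general_linear_group" "g \<in> carrier G"
  shows "card {y \<in> orbit G (matrix_action (generic_rep \<rho>)) generic_vec. ratvec_eval y v = \<rho> g *v v}
    dvd card (stabilizer G (matrix_action \<rho>) v)"
proof -
  let ?f = "\<lambda>a. generic_rep \<rho> a *v generic_vec"
  let ?F = "{a \<in> carrier G. \<rho> a *v v = \<rho> g *v v}"
  let ?S = "{y \<in> orbit G (matrix_action (generic_rep \<rho>)) generic_vec. ratvec_eval y v = \<rho> g *v v}"
  let ?K = "stabilizer G (matrix_action (generic_rep \<rho>)) generic_vec"
  have S: "?S = ?f ` ?F"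
    by (auto simp: orbit_def matrix_action_def generic_orbit_at)
  have fibre: "card {a \<in> ?F. ?f a = y} = card ?K" if "y \<in> ?f ` ?F" for y
  proof -
    from that obtain b where b: "b \<in> ?F" "y = ?f b" by blast
    \<comment> \<open>Evaluating at \<open>v\<close> shows that a fibre of the generic orbit map
      meeting \<open>?F\<close> lies entirely in \<open>?F\<close>, so it is a full coset of
      \<open>?K\<close>.\<close>
    have "\<rho> a *v v = \<rho> b *v v" if "?f a = ?f b" for a
      using that generic_orbit_at(2) by metis
    then have "{a \<in> ?F. ?f a = y} = {a \<in> carrier G. ?f a = ?f b}"
      unfolding b(2) using b(1) by (intro Collect_cong) (metis (mono_tags, lifting) mem_Collect_eq)
    moreover have "b \<in> carrier G" using b(1) by simp
    ultimately show ?thesis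
      using card_action_fibre[OF assms(1) generic_rep_hom[OF assms(3)]] by simp
  qed
  have "card ?F = (\<Sum>y\<in>?f ` ?F. card {a \<in> ?F. ?f a = y})"
    using sum.image_gen[of ?F "\<lambda>_. 1::nat" ?f] assms(2) by simp
  also have "\<dots> = (\<Sum>y\<in>?f ` ?F. card ?K)"
    by (rule sum.cong[OF refl fibre])
  also have "\<dots> = card ?S * card ?K"
    unfolding S by (simp only: sum_constant of_nat_id)
  finally show ?thesis
    unfolding card_action_fibre[OF assms(1,3,4)] by (rule dvdI)
qed

section \<open>Evaluation of matrices that permute the generic orbit\<close>

lemma GL_orbit_image:
  "A \<in> GL_orbit G \<rho> x \<Longrightarrow> (\<lambda>y. A *v y) ` orbit G (matrix_action \<rho>) x = orbit G (matrix_action \<rho>) x"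
  by (simp add: GL_orbit_def)

text \<open>The range of \<open>A\<close> is the span of the image of \<open>S\<close>, hence the
  whole space; a surjective square matrix is invertible.\<close>

lemma invertible_if_permutes_spanning:
  fixes A :: "'k::field ^ 'n ^ 'n"
  assumes "(\<lambda>y. A *v y) ` S = S" "vec.span S = UNIV"
  shows "invertible A"
proof -
  have "vec.span ((\<lambda>y. A *v y) ` S) = (\<lambda>y. A *v y) ` vec.span S"
    by (rule vec.span_image)
  then have "surj (\<lambda>y. A *v y)" using assms by simp
  then show ?thesis
    using invertible_right_inverse matrix_right_invertible_surjective by blast
qed

theorem lemma3p2:
  fixes G :: "('g, 'b) monoid_scheme"
    and \<rho> :: "'g \<Rightarrow> 'k::field ^ 'n::{finite,linorder} ^ 'n::{finite,linorder}"
    and v :: "'k ^ 'n::{finite,linorder}"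
  assumes "group G" and "finite (carrier G)"
    and "infinite (UNIV :: 'k set)"
    and "\<rho> \<in> hom G general_linear_group"
    and "cyclic_module G \<rho>"
    and "v \<in> Gens G \<rho>"
    and "\<not> CHAR('k) dvd card (stabilizer G (matrix_action \<rho>) v)"
  shows "(\<forall>A \<in> GL_orbit G (generic_rep \<rho>) generic_vec. ratmat_defined_at A v)
    \<and> (\<lambda>A. ratmat_eval A v) \<in> GL_orbit G (generic_rep \<rho>) generic_vec \<rightarrow> GL_orbit G \<rho> v
    \<and> inj_on (\<lambda>A. ratmat_eval A v) (GL_orbit G (generic_rep \<rho>) generic_vec)"
proof -
  let ?GX = "orbit G (matrix_action (generic_rep \<rho>)) generic_vec"
  let ?Gv = "orbit G (matrix_action \<rho>) v"
  let ?GL = "GL_orbit G (generic_rep \<rho>) generic_vec"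
  have GX: "?GX = (\<lambda>g. generic_rep \<rho> g *v generic_vec) ` carrier G"
    by (auto simp: orbit_def matrix_action_def)
  have Gv: "?Gv = (\<lambda>g. \<rho> g *v v) ` carrier G"
    by (auto simp: orbit_def matrix_action_def)
  have orbit_values: "(\<lambda>y. ratvec_eval y v) ` ?GX = ?Gv"
    by (simp add: GX Gv image_image generic_orbit_at)
  have span: "vec.span ?Gv = UNIV" using assms(6) by (simp add: Gens_def)
  have GX_defined: "ratvec_defined_at y v" if "y \<in> ?GX" for y
    using that by (auto simp: GX generic_orbit_at)
  have GX_closed: "A *v y \<in> ?GX" if "A \<in> ?GL" "y \<in> ?GX" for A y
    using GL_orbit_image[OF that(1)] that(2) by blast
  have A_defined: "ratmat_defined_at A v" if "A \<in> ?GL" for A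
  proof (rule ratmat_defined_at_if_images_defined)
    show "vec.span ((\<lambda>y. ratvec_eval y v) ` ?GX) = UNIV"
      by (simp only: orbit_values span)
  qed (use that GX_defined GX_closed in blast)+
  have A_value: "ratvec_eval (A *v y) v = ratmat_eval A v *v ratvec_eval y v"
    if "A \<in> ?GL" "y \<in> ?GX" for A y
    using that A_defined GX_defined ratvec_mult_at(2) by blast
  have eval_GL: "ratmat_eval A v \<in> GL_orbit G \<rho> v" if A: "A \<in> ?GL" for A
  proof -
    have "(\<lambda>y. ratmat_eval A v *v y) ` ?Gv = (\<lambda>y. ratvec_eval (A *v y) v) ` ?GX"
      using A_value[OF A] by (simp add: image_image flip: orbit_values)
    also have "\<dots> = (\<lambda>y. ratvec_eval y v) ` (\<lambda>y. A *v y) ` ?GX"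
      by (simp add: image_image)
    also have "\<dots> = ?Gv"
      by (simp only: GL_orbit_image[OF A] orbit_values)
    finally have image: "(\<lambda>y. ratmat_eval A v *v y) ` ?Gv = ?Gv" .
    with invertible_if_permutes_spanning[OF image span] show ?thesis
      by (simp add: GL_orbit_def)
  qed
  have "A = B"
    if AB: "A \<in> ?GL" "B \<in> ?GL" and eq: "ratmat_eval A v = ratmat_eval B v" for A B
  proof -
    \<comment> \<open>The fibres are indexed by the value \<open>z\<close> instead of a group
      element, so that the fibre onto which a matrix maps \<open>S z\<close> can be named
      directly.\<close>
    define S where "S z = {y \<in> ?GX. ratvec_eval y v = z}" for z
    have sum_image: "C *v (\<Sum>y\<in>S z. y) = (\<Sum>y\<in>S (ratmat_eval C v *v z). y)"
      if C: "C \<in> ?GL" and z: "z \<in> ?Gv" for C z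
    proof -
      have inv: "invertible (ratmat_eval C v)" "invertible C"
        using C eval_GL[OF C] by (simp_all add: GL_orbit_def)
      have image: "(\<lambda>y. C *v y) ` S z = S (ratmat_eval C v *v z)"
      proof (intro equalityI subsetI)
        \<comment> \<open>As \<open>C\<close> permutes the generic orbit, \<open>y\<close> has a
          preimage \<open>x\<close> in it; injectivity of the evaluated matrix forces the value of
          \<open>x\<close> to be \<open>z\<close>.\<close>
        fix y assume "y \<in> S (ratmat_eval C v *v z)"
        then have y: "y \<in> ?GX" "ratvec_eval y v = ratmat_eval C v *v z" by (auto simp: S_def)
        then obtain x where x: "x \<in> ?GX" "y = C *v x" using GL_orbit_image[OF C] by blast
        then have "ratmat_eval C v *v ratvec_eval x v = ratmat_eval C v *v z"
          using y A_value[OF C] by simp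
        then have "ratvec_eval x v = z"
          using inj_matrix_vector_mult[OF inv(1)] by (auto dest: injD)
        then show "y \<in> (\<lambda>y. C *v y) ` S z" using x by (auto simp: S_def)
      next
        fix y assume "y \<in> (\<lambda>y. C *v y) ` S z"
        then obtain x where "x \<in> ?GX" "ratvec_eval x v = z" "y = C *v x"
          by (auto simp: S_def)
        then show "y \<in> S (ratmat_eval C v *v z)"
          using GX_closed[OF C, of x] A_value[OF C, of x] by (simp add: S_def)
      qed
      have "inj_on (\<lambda>y. C *v y) (S z)"
        using inj_matrix_vector_mult[OF inv(2)] by (rule inj_on_subset) simp
      then have "(\<Sum>y\<in>S (ratmat_eval C v *v z). y) = (\<Sum>y\<in>S z. C *v y)"
        unfolding image[symmetric] by (simp add: sum.reindex)
      then show ?thesis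
        by (simp add: vec.linear_sum[OF matrix_vector_mul_linear_gen])
    qed
    have S_value: "ratvec_eval (\<Sum>y\<in>S z. y) v = of_nat (card (S z)) *s z" for z
    proof -
      have "ratvec_eval (\<Sum>y\<in>S z. y) v = (\<Sum>y\<in>S z. ratvec_eval y v)"
        by (rule ratvec_sum_at) (simp add: S_def GX_defined)
      also have "\<dots> = (\<Sum>y\<in>S z. z)" by (rule sum.cong) (auto simp: S_def)
      also have "\<dots> = of_nat (card (S z)) *s z"
        unfolding vec_eq_iff sum_component vector_smult_component by simp
      finally show ?thesis .
    qed
    have card_S: "of_nat (card (S z)) \<noteq> (0 :: 'k)" if z: "z \<in> ?Gv" for z
    proof -
      have "card (S z) dvd card (stabilizer G (matrix_action \<rho>) v)"
        using z card_orbit_values_dvd[OF assms(1,2,4)] by (auto simp: S_def Gv)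
      \<comment> \<open>If the cardinality were zero in the field, the characteristic would divide
        it, and with it the order of the stabilizer.\<close>
      then show ?thesis using assms(7) by (meson dvd_trans of_nat_eq_0_iff_char_dvd)
    qed
    let ?W = "(\<lambda>z. \<Sum>y\<in>S z. y) ` ?Gv"
    have "vec.span ((\<lambda>w. ratvec_eval w v) ` ?W) = vec.span ((\<lambda>z. of_nat (card (S z)) *s z) ` ?Gv)"
      by (simp add: image_image S_value)
    also have "\<dots> = UNIV"
      \<comment> \<open>Rescaling the vectors of the finite orbit by nonzero scalars preserves their
        span.\<close>
      using assms(2) card_S span by (subst vec.span_image_scale) (auto simp: Gv)
    finally show "A = B"
    proof (rule ratmat_eq_on_spanning_values)
      show "ratvec_defined_at w v" if "w \<in> ?W" for w
      proof -
        from that obtain z where z: "w = (\<Sum>y\<in>S z. y)" by (rule imageE)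
        show ?thesis
          unfolding z by (rule ratvec_sum_at) (simp add: S_def GX_defined)
      qed
      show "A *v w = B *v w" if w: "w \<in> ?W" for w
      proof -
        from w obtain z where z: "z \<in> ?Gv" "w = (\<Sum>y\<in>S z. y)" by (rule imageE)
        show ?thesis
          \<comment> \<open>Both sides become sums over fibres, and \<open>eq\<close> says that
            these fibres lie over the same point.\<close>
          unfolding z(2) sum_image[OF AB(1) z(1)] sum_image[OF AB(2) z(1)] eq ..
      qed
    qed
  qed
  then have "inj_on (\<lambda>A. ratmat_eval A v) ?GL" by (rule inj_onI)
  with A_defined eval_GL show ?thesis by blast
qed

end
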